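(* The categories $\mathcal O^{m|n}_{\bf b}$ are identical for all $0^m1^n$-sequences ${\bf b}$.
   Context: A $0^m1^n$-sequence is ${\bf b}=(b_1,\dots,b_{m+n})$ with $m$ entries $0$ and $n$ entries $1$. $\mathfrak{gl}(m|n)$ (over $\mathbb C$) acts on $\mathbb C^{m|n}$ with even basis $e_1,\dots,e_m$ and odd basis $e_{m+1},\dots,e_{m+n}$; $\mathfrak h_{m|n}$ is the diagonal Cartan subalgebra, $\{\epsilon_i\}$ is the basis of $\mathfrak h_{m|n}^*$ dual to $\{e_{ii}\}$, and $X(m|n)=\sum_i\mathbb Z\epsilon_i$. Let $i_1<\dots<i_m$ be the positions of $0$'s in ${\bf b}$ and $j_1<\dots<j_n$ those of $1$'s; set $\epsilon^{\bf b}_{i_k}=\epsilon_k$, $\epsilon^{\bf b}_{j_l}=\epsilon_{m+l}$, and $\Pi({\bf b})=\{\epsilon^{\bf b}_i-\epsilon^{\bf b}_{i+1}\mid1\le i\le m+n-1\}$ (the simple roots of the Borel subalgebra associated to ${\bf b}$). $\mathcal O^{m|n}_{\bf b}$ is the category of finitely generated $\mathfrak h_{m|n}$-semisimple $\mathfrak{gl}(m|n)$-modules $M$ such that (i) $M=\bigoplus_{\mu\in X(m|n)}M_\mu$ with $\dim M_\mu<\infty$; (ii) there exist finitely many weights ${}^1\lambda,\dots,{}^k\lambda\in X(m|n)$ (depending on $M$) such that every weight $\mu$ of $M$ lies in ${}^i\lambda-\sum_{\alpha\in\Pi({\bf b})}\mathbb Z_+\alpha$ for some $i$. Morphisms are all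 (not necessarily even) homomorphisms of $\mathfrak{gl}(m|n)$-modules. *)

theory Defs
  imports
    Complex_Main
    "HOL-Library.FuncSet"
    "HOL-Library.Z2"
    "Jordan_Normal_Form.Matrix"
begin

text \<open>All indices are shifted to start at 0: the basis of \<open>\<complex>\<^bsup>m|n\<^esup>\<close> is indexed by
  \<open>0, \<dots>, m+n-1\<close>, the first \<open>m\<close> indices being even. Parities live in the field \<^typ>\<open>bit\<close>.\<close>

definition is_01_sequence :: "nat \<Rightarrow> nat \<Rightarrow> nat list \<Rightarrow> bool" where
  "is_01_sequence m n b \<longleftrightarrow> length b = m + n \<and> count_list b 0 = m \<and> count_list b 1 = n"


section \<open>The Lie superalgebra gl(m|n)\<close>

definition index_parity :: "nat \<Rightarrow> nat \<Rightarrow> bit" where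
  "index_parity m i = (if i < m then 0 else 1)"

definition gl :: "nat \<Rightarrow> nat \<Rightarrow> complex mat set" where
  "gl m n = carrier_mat (m + n) (m + n)"

definition gl_part :: "nat \<Rightarrow> nat \<Rightarrow> bit \<Rightarrow> complex mat set" where
  "gl_part m n p = {X \<in> gl m n. \<forall>i<m + n. \<forall>j<m + n.
     X $$ (i, j) \<noteq> 0 \<longrightarrow> index_parity m i + index_parity m j = p}"

text \<open>The sign \<open>(-1)\<^sup>p\<close>.\<close>

definition parity_sign :: "bit \<Rightarrow> complex" where
  "parity_sign p = (if p = 0 then 1 else - 1)"

text \<open>\<open>superbracket p q X Y\<close> is \<open>[X, Y]\<close> for \<open>X\<close>, \<open>Y\<close> homogeneous of parities \<open>p\<close>, \<open>q\<close>.\<close>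

definition superbracket :: "bit \<Rightarrow> bit \<Rightarrow> complex mat \<Rightarrow> complex mat \<Rightarrow> complex mat" where
  "superbracket p q X Y = X * Y - parity_sign (p * q) \<cdot>\<^sub>m (Y * X)"

definition cartan :: "nat \<Rightarrow> nat \<Rightarrow> complex mat set" where
  "cartan m n = {h \<in> gl m n. diagonal_mat h}"


section \<open>Weights\<close>

text \<open>An element of the dual of the Cartan subalgebra is given by its coordinate vector (in
  \<^term>\<open>carrier_vec (m + n)\<close>) with respect to the basis dual to the diagonal matrix units.\<close>

definition weight_eval :: "nat \<Rightarrow> nat \<Rightarrow> complex vec \<Rightarrow> complex mat \<Rightarrow> complex" where
  "weight_eval m n \<mu> h = (\<Sum>i<m + n. \<mu> $ i * h $$ (i, i))"

definition integral_weights :: "nat \<Rightarrow> nat \<Rightarrow> complex vec set" where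
  "integral_weights m n = {\<mu> \<in> carrier_vec (m + n). \<forall>i<m + n. \<mu> $ i \<in> \<int>}"

text \<open>If position \<open>i\<close> carries the \<open>k\<close>-th zero (or one) of \<open>b\<close>, counting from 0, then \<open>k\<close> is the
  number of zeros (or ones) strictly before position \<open>i\<close>.\<close>

definition eps :: "nat \<Rightarrow> nat \<Rightarrow> nat list \<Rightarrow> nat \<Rightarrow> complex vec" where
  "eps m n b i = unit_vec (m + n)
     (if b ! i = 0 then card {j. j < i \<and> b ! j = 0} else m + card {j. j < i \<and> b ! j = 1})"

definition simple_roots :: "nat \<Rightarrow> nat \<Rightarrow> nat list \<Rightarrow> complex vec set" where
  "simple_roots m n b = {eps m n b i - eps m n b (i + 1) | i. i + 1 < m + n}"

text \<open>The set \<open>\<lambda> - \<Sum>\<^bsub>\<alpha> \<in> \<Pi>(b)\<^esub> \<int>\<^sub>+ \<alpha>\<close>.\<close>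

definition lower_cone :: "nat \<Rightarrow> nat \<Rightarrow> nat list \<Rightarrow> complex vec \<Rightarrow> complex vec set" where
  "lower_cone m n b l =
     {vec (m + n) (\<lambda>i. l $ i - (\<Sum>\<alpha>\<in>simple_roots m n b. of_nat (c \<alpha>) * \<alpha> $ i))
       | c :: complex vec \<Rightarrow> nat. True}"


section \<open>Modules over gl(m|n)\<close>

text \<open>The underlying spaces of modules are subspaces of an ambient complex vector space, which
  is arbitrary and only serves to bound the size of the modules. The values of \<open>act M\<close> outside
  \<^term>\<open>gl m n\<close> and outside \<open>space M\<close> are irrelevant.\<close>

record 'v glmod =
  space :: "'v set"
  part :: "bit \<Rightarrow> 'v set"
  act :: "complex mat \<Rightarrow> 'v \<Rightarrow> 'v"

record ('o, 'm) cat =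
  Obj :: "'o set"
  Hom :: "'o \<Rightarrow> 'o \<Rightarrow> 'm set"
  Id :: "'o \<Rightarrow> 'm"
  Comp :: "'o \<Rightarrow> 'o \<Rightarrow> 'o \<Rightarrow> 'm \<Rightarrow> 'm \<Rightarrow> 'm"

locale complex_vector_space = vector_space scale
  for scale :: "complex \<Rightarrow> 'v::ab_group_add \<Rightarrow> 'v"
begin

definition internal_direct_sum :: "'v set \<Rightarrow> 'i set \<Rightarrow> ('i \<Rightarrow> 'v set) \<Rightarrow> bool" where
  "internal_direct_sum V I N \<longleftrightarrow>
     (\<forall>i\<in>I. subspace (N i) \<and> N i \<subseteq> V) \<and>
     (\<forall>v\<in>V. \<exists>!f. (\<forall>i\<in>I. f i \<in> N i) \<and> (\<forall>i. i \<notin> I \<longrightarrow> f i = 0) \<and>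
        finite {i. f i \<noteq> 0} \<and> v = (\<Sum>i | f i \<noteq> 0. f i))"

definition fin_dim :: "'v set \<Rightarrow> bool" where
  "fin_dim W \<longleftrightarrow> (\<exists>B. finite B \<and> W = span B)"

definition is_gl_module :: "nat \<Rightarrow> nat \<Rightarrow> 'v glmod \<Rightarrow> bool" where
  "is_gl_module m n M \<longleftrightarrow>
     subspace (space M) \<and>
     internal_direct_sum (space M) UNIV (part M) \<and>
     (\<forall>X\<in>gl m n. \<forall>v\<in>space M. act M X v \<in> space M) \<and>
     (\<forall>X\<in>gl m n. \<forall>v\<in>space M. \<forall>w\<in>space M. act M X (v + w) = act M X v + act M X w) \<and>
     (\<forall>X\<in>gl m n. \<forall>v\<in>space M. \<forall>a. act M X (scale a v) = scale a (act M X v)) \<and>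
     (\<forall>X\<in>gl m n. \<forall>Y\<in>gl m n. \<forall>v\<in>space M. act M (X + Y) v = act M X v + act M Y v) \<and>
     (\<forall>X\<in>gl m n. \<forall>v\<in>space M. \<forall>a. act M (a \<cdot>\<^sub>m X) v = scale a (act M X v)) \<and>
     (\<forall>p q. \<forall>X\<in>gl_part m n p. \<forall>v\<in>part M q. act M X v \<in> part M (p + q)) \<and>
     (\<forall>p q. \<forall>X\<in>gl_part m n p. \<forall>Y\<in>gl_part m n q. \<forall>v\<in>space M.
        act M (superbracket p q X Y) v =
          act M X (act M Y v) - scale (parity_sign (p * q)) (act M Y (act M X v)))"

definition is_submodule :: "nat \<Rightarrow> nat \<Rightarrow> 'v glmod \<Rightarrow> 'v set \<Rightarrow> bool" where
  "is_submodule m n M W \<longleftrightarrow>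
     subspace W \<and> W \<subseteq> space M \<and> (\<forall>X\<in>gl m n. \<forall>v\<in>W. act M X v \<in> W)"

definition finitely_generated :: "nat \<Rightarrow> nat \<Rightarrow> 'v glmod \<Rightarrow> bool" where
  "finitely_generated m n M \<longleftrightarrow>
     (\<exists>S. finite S \<and> S \<subseteq> space M \<and> (\<forall>W. is_submodule m n M W \<and> S \<subseteq> W \<longrightarrow> W = space M))"

definition weight_space :: "nat \<Rightarrow> nat \<Rightarrow> 'v glmod \<Rightarrow> complex vec \<Rightarrow> 'v set" where
  "weight_space m n M \<mu> =
     {v \<in> space M. \<forall>h\<in>cartan m n. act M h v = scale (weight_eval m n \<mu> h) v}"

definition weights :: "nat \<Rightarrow> nat \<Rightarrow> 'v glmod \<Rightarrow> complex vec set" where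
  "weights m n M = {\<mu> \<in> carrier_vec (m + n). weight_space m n M \<mu> \<noteq> {0}}"

definition cartan_semisimple :: "nat \<Rightarrow> nat \<Rightarrow> 'v glmod \<Rightarrow> bool" where
  "cartan_semisimple m n M \<longleftrightarrow>
     internal_direct_sum (space M) (carrier_vec (m + n)) (weight_space m n M)"

text \<open>A homogeneous homomorphism of parity \<open>p\<close> supercommutes with the action:
  \<open>f (X v) = (-1)\<^bsup>p|X|\<^esup> X (f v)\<close>. A general homomorphism is a sum of an even and an odd one.\<close>

definition is_homogeneous_hom ::
  "nat \<Rightarrow> nat \<Rightarrow> bit \<Rightarrow> 'v glmod \<Rightarrow> 'v glmod \<Rightarrow> ('v \<Rightarrow> 'v) \<Rightarrow> bool" where
  "is_homogeneous_hom m n p M N f \<longleftrightarrow>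
     (\<forall>v\<in>space M. f v \<in> space N) \<and>
     (\<forall>v\<in>space M. \<forall>w\<in>space M. f (v + w) = f v + f w) \<and>
     (\<forall>v\<in>space M. \<forall>a. f (scale a v) = scale a (f v)) \<and>
     (\<forall>q. \<forall>v\<in>part M q. f v \<in> part N (p + q)) \<and>
     (\<forall>q. \<forall>X\<in>gl_part m n q. \<forall>v\<in>space M.
        f (act M X v) = scale (parity_sign (p * q)) (act N X (f v)))"

definition gl_hom :: "nat \<Rightarrow> nat \<Rightarrow> 'v glmod \<Rightarrow> 'v glmod \<Rightarrow> ('v \<Rightarrow> 'v) set" where
  "gl_hom m n M N = {f \<in> extensional (space M).
     \<exists>g. (\<forall>p. is_homogeneous_hom m n p M N (g p)) \<and> (\<forall>v\<in>space M. f v = g 0 v + g 1 v)}"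

definition in_O :: "nat \<Rightarrow> nat \<Rightarrow> nat list \<Rightarrow> 'v glmod \<Rightarrow> bool" where
  "in_O m n b M \<longleftrightarrow>
     is_gl_module m n M \<and> finitely_generated m n M \<and> cartan_semisimple m n M \<and>
     internal_direct_sum (space M) (integral_weights m n) (weight_space m n M) \<and>
     (\<forall>\<mu>\<in>integral_weights m n. fin_dim (weight_space m n M \<mu>)) \<and>
     (\<exists>L. finite L \<and> L \<subseteq> integral_weights m n \<and>
        (\<forall>\<mu>\<in>weights m n M. \<exists>l\<in>L. \<mu> \<in> lower_cone m n b l))"

definition category_O :: "nat \<Rightarrow> nat \<Rightarrow> nat list \<Rightarrow> ('v glmod, 'v \<Rightarrow> 'v) cat" where
  "category_O m n b =
     \<lparr> Obj = {M. in_O m n b M},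
       Hom = (\<lambda>M N. if in_O m n b M \<and> in_O m n b N then gl_hom m n M N else {}),
       Id = (\<lambda>M. restrict id (space M)),
       Comp = (\<lambda>M N P g f. compose (space M) g f) \<rparr>"

end

end

theory Submission
  imports Defs
begin

text \<open>The even positive roots are the same for all sequences, so the growth condition on the weights
  can be expressed through them alone: it holds for \<open>b\<close> iff the total of the coordinates
  of the weights is bounded and the partial sums of the even and of the odd coordinates are each
  bounded above. For the nontrivial direction, let \<open>T\<close> be the sum of the weight spaces on
  which these partial sums exceed a fixed constant chosen so that \<open>T\<close> contains a finite
  generating set. Since the condition for \<open>b\<close> bounds sums of one even and one odd partial sum
  from above, the partial sums are bounded above on \<open>T\<close> too. The closure \<open>W\<close> of \<open>T\<close> under even
  lowering operators is stable under the even subalgebra and keeps the upper bound. As odd matrix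
  units anticommute up to even ones and square to zero, words of at most \<open>2mn\<close> of them
  applied to \<open>W\<close> span the module, and each letter raises the bound by at most 1.\<close>

section \<open>Matrix units\<close>

definition munit :: "nat \<Rightarrow> nat \<Rightarrow> nat \<Rightarrow> complex mat" where
  "munit N i j = mat N N (\<lambda>(a, b). if a = i \<and> b = j then 1 else 0)"

lemma munit_carrier [simp]: "munit N i j \<in> carrier_mat N N"
  by (simp add: munit_def)

lemma munit_gl [simp]: "munit (m + n) i j \<in> gl m n"
  by (simp add: gl_def)

text \<open>The only entry that can be nonzero sits at \<open>(i, j)\<close>; for indices out of
  range the matrix is zero and lies in both parts.\<close>

lemma munit_gl_part: "munit (m + n) i j \<in> gl_part m n (index_parity m i + index_parity m j)"
  by (auto simp: gl_part_def) (auto simp: munit_def split: if_splits)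

lemma munit_mult:
  assumes "i < N" "j < N" "k < N" "l < N"
  shows "munit N i j * munit N k l = (if j = k then munit N i l else 0\<^sub>m N N)"
proof (rule eq_matI)
  fix a b assume "a < dim_row (if j = k then munit N i l else 0\<^sub>m N N)"
    "b < dim_col (if j = k then munit N i l else 0\<^sub>m N N)"
  then have ab: "a < N" "b < N"
    by (auto simp: munit_def split: if_splits)
  have "(munit N i j * munit N k l) $$ (a, b) =
      (\<Sum>c\<in>{0..<N}. (if a = i \<and> c = j then 1 else 0) * (if c = k \<and> b = l then 1 else 0))"
    using ab by (simp add: munit_def scalar_prod_def)
  also have "\<dots> = (\<Sum>c\<in>{0..<N}. if c = j then (if a = i \<and> j = k \<and> b = l then 1 else 0) else 0)"
    by (intro sum.cong) auto
  also have "\<dots> = (if j = k then munit N i l else 0\<^sub>m N N) $$ (a, b)"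
    using ab assms by (simp add: munit_def)
  finally show "(munit N i j * munit N k l) $$ (a, b) =
      (if j = k then munit N i l else 0\<^sub>m N N) $$ (a, b)" .
qed (auto simp: munit_def)

lemma munit_cartan [simp]: "munit (m + n) k k \<in> cartan m n"
  by (auto simp: cartan_def diagonal_mat_def) (auto simp: munit_def)

lemma weight_eval_munit:
  assumes "k < m + n"
  shows "weight_eval m n \<mu> (munit (m + n) k k) = \<mu> $ k"
proof -
  have "weight_eval m n \<mu> (munit (m + n) k k) = (\<Sum>i<m + n. if i = k then \<mu> $ k else 0)"
    unfolding weight_eval_def by (intro sum.cong) (auto simp: munit_def)
  then show ?thesis
    using assms by simp
qed

section \<open>Action of the matrix units\<close>

locale gl_module = complex_vector_space scale
  for scale :: "complex \<Rightarrow> 'v::ab_group_add \<Rightarrow> 'v" +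
  fixes m n :: nat and M :: "'v glmod"
  assumes is_gl_module: "is_gl_module m n M"
begin

abbreviation "par \<equiv> index_parity m"

definition op :: "nat \<Rightarrow> nat \<Rightarrow> 'v \<Rightarrow> 'v" where
  "op i j = act M (munit (m + n) i j)"

text \<open>The Koszul sign for swapping two matrix units, whose parities are
  \<open>par i + par j\<close> and \<open>par k + par l\<close>.\<close>

definition comm_sign :: "nat \<Rightarrow> nat \<Rightarrow> nat \<Rightarrow> nat \<Rightarrow> complex" where
  "comm_sign i j k l = parity_sign ((par i + par j) * (par k + par l))"

lemma subspace_space: "subspace (space M)"
  using is_gl_module by (simp add: is_gl_module_def)

lemma act_closed: "X \<in> gl m n \<Longrightarrow> v \<in> space M \<Longrightarrow> act M X v \<in> space M"
  and act_add: "X \<in> gl m n \<Longrightarrow> v \<in> space M \<Longrightarrow> w \<in> space M \<Longrightarrow>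
      act M X (v + w) = act M X v + act M X w"
  and act_scale: "X \<in> gl m n \<Longrightarrow> v \<in> space M \<Longrightarrow> act M X (scale a v) = scale a (act M X v)"
  and act_mat_add: "X \<in> gl m n \<Longrightarrow> Y \<in> gl m n \<Longrightarrow> v \<in> space M \<Longrightarrow>
      act M (X + Y) v = act M X v + act M Y v"
  and act_mat_smult: "X \<in> gl m n \<Longrightarrow> v \<in> space M \<Longrightarrow> act M (a \<cdot>\<^sub>m X) v = scale a (act M X v)"
  and act_superbracket: "X \<in> gl_part m n p \<Longrightarrow> Y \<in> gl_part m n q \<Longrightarrow> v \<in> space M \<Longrightarrow>
      act M (superbracket p q X Y) v =
        act M X (act M Y v) - scale (parity_sign (p * q)) (act M Y (act M X v))"
  using is_gl_module unfolding is_gl_module_def by auto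

lemma act_mat_zero: "v \<in> space M \<Longrightarrow> act M (0\<^sub>m (m + n) (m + n)) v = 0"
  using act_mat_smult[of "0\<^sub>m (m + n) (m + n)" v 0] by (simp add: gl_def)

lemma op_closed [simp]: "v \<in> space M \<Longrightarrow> op i j v \<in> space M"
  and op_add: "v \<in> space M \<Longrightarrow> w \<in> space M \<Longrightarrow> op i j (v + w) = op i j v + op i j w"
  and op_scale: "v \<in> space M \<Longrightarrow> op i j (scale a v) = scale a (op i j v)"
  by (simp_all add: op_def act_closed act_add act_scale)

lemma op_zero [simp]: "op i j 0 = 0"
  using op_scale[of 0 i j 0] subspace_0[OF subspace_space] by simp

text \<open>The superbracket relation solved for the first product: swapping two matrix units costs
  a sign and single matrix units. All reordering arguments below rest on this.\<close>

lemma op_commute: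
  assumes "i < m + n" "j < m + n" "k < m + n" "l < m + n" and v: "v \<in> space M"
  shows "op i j (op k l v) = scale (comm_sign i j k l) (op k l (op i j v))
    + (if j = k then op i l v else 0) - scale (comm_sign i j k l) (if l = i then op k j v else 0)"
proof -
  define s where "s = comm_sign i j k l"
  define A where "A = (if j = k then munit (m + n) i l else 0\<^sub>m (m + n) (m + n))"
  define B where "B = (if l = i then munit (m + n) k j else 0\<^sub>m (m + n) (m + n))"
  have AB: "A \<in> gl m n" "B \<in> gl m n"
    by (auto simp: A_def B_def gl_def)
  then have AB': "A \<in> carrier_mat (m + n) (m + n)" "B \<in> carrier_mat (m + n) (m + n)"
    by (auto simp: gl_def)
  have "superbracket (par i + par j) (par k + par l) (munit (m + n) i j) (munit (m + n) k l)
      = A - s \<cdot>\<^sub>m B"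
    using assms by (simp add: superbracket_def munit_mult A_def B_def s_def comm_sign_def)
  \<comment> \<open>The module axioms speak of sums and scalar multiples of matrices, not of
    differences.\<close>
  also have "\<dots> = A + (- s) \<cdot>\<^sub>m B"
    using AB' by (intro eq_matI) auto
  finally have br: "superbracket (par i + par j) (par k + par l)
      (munit (m + n) i j) (munit (m + n) k l) = A + (- s) \<cdot>\<^sub>m B" .
  have "- s \<cdot>\<^sub>m B \<in> gl m n"
    using AB by (simp add: gl_def)
  then have "act M (A + (- s) \<cdot>\<^sub>m B) v = act M A v - scale s (act M B v)"
    using act_mat_add[OF AB(1) _ v] act_mat_smult[OF AB(2) v] by simp
  then have "op i j (op k l v) - scale s (op k l (op i j v)) = act M A v - scale s (act M B v)"
    using act_superbracket[OF munit_gl_part munit_gl_part v, of i j k l] br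
    unfolding op_def s_def comm_sign_def by simp
  then have "op i j (op k l v) = scale s (op k l (op i j v)) + act M A v - scale s (act M B v)"
    by (simp add: diff_eq_eq)
  moreover have "act M A v = (if j = k then op i l v else 0)"
    using act_mat_zero[OF v] by (simp add: A_def op_def)
  moreover have "act M B v = (if l = i then op k j v else 0)"
    using act_mat_zero[OF v] by (simp add: B_def op_def)
  ultimately show ?thesis
    by (simp only: s_def)
qed

lemma span_subset_space: "A \<subseteq> space M \<Longrightarrow> span A \<subseteq> space M"
  by (rule span_minimal[OF _ subspace_space])

text \<open>The vectors of \<open>space M\<close> that \<open>op i j\<close> sends into
  \<open>V\<close> form a subspace, so it is enough to test a spanning set.\<close>

lemma op_span:
  assumes "A \<subseteq> space M" "\<And>v. v \<in> A \<Longrightarrow> op i j v \<in> V" "subspace V" "v \<in> span A"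
  shows "op i j v \<in> V"
proof -
  have "subspace {v \<in> space M. op i j v \<in> V}"
    using assms(3) subspace_space
    by (auto simp: subspace_def op_add op_scale)
  then have "span A \<subseteq> {v \<in> space M. op i j v \<in> V}"
    using assms by (intro span_minimal) auto
  then show ?thesis
    using assms by auto
qed

text \<open>Every \<open>X\<close> is the sum of its entries times matrix units; the induction is over the set of
  entries kept.\<close>

lemma act_closed_from_op:
  assumes V: "subspace V" and v: "v \<in> space M"
    and X: "X \<in> gl m n"
    and op: "\<And>i j. i < m + n \<Longrightarrow> j < m + n \<Longrightarrow> X $$ (i, j) \<noteq> 0 \<Longrightarrow> op i j v \<in> V"
  shows "act M X v \<in> V"
proof -
  let ?N = "m + n"
  define R where "R F = mat ?N ?N (\<lambda>p. if p \<in> F then X $$ p else 0)" for F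
  have "act M (R F) v \<in> V" if "finite F" "F \<subseteq> {..<?N} \<times> {..<?N}" for F
    using that
  proof (induction F rule: finite_induct)
    case empty
    have "R {} = 0\<^sub>m ?N ?N"
      by (auto simp: R_def)
    then show ?case
      using subspace_0[OF V] act_mat_zero[OF v] by simp
  next
    case (insert p F)
    obtain i j where p: "p = (i, j)" by force
    have ij: "i < ?N" "j < ?N"
      using insert.prems p by auto
    have "R (insert p F) = R F + X $$ (i, j) \<cdot>\<^sub>m munit ?N i j"
      using insert.hyps p by (intro eq_matI) (auto simp: R_def munit_def)
    moreover have "R F \<in> gl m n"
      by (simp add: R_def gl_def)
    moreover have "X $$ (i, j) \<cdot>\<^sub>m munit ?N i j \<in> gl m n"
      by (simp add: gl_def)
    ultimately have *: "act M (R (insert p F)) v = act M (R F) v + scale (X $$ (i, j)) (op i j v)"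
      using v by (simp add: act_mat_add act_mat_smult op_def)
    have "scale (X $$ (i, j)) (op i j v) \<in> V"
      using op[OF ij] subspace_scale[OF V] subspace_0[OF V] by (cases "X $$ (i, j) = 0") auto
    then show ?case
      using * insert V by (simp add: subspace_add)
  qed
  from this[of "{..<?N} \<times> {..<?N}"] have "act M (R ({..<?N} \<times> {..<?N})) v \<in> V"
    by auto
  moreover have "R ({..<?N} \<times> {..<?N}) = X"
    using X by (intro eq_matI) (auto simp: R_def gl_def)
  ultimately show ?thesis
    by simp
qed

lemma is_submoduleI:
  assumes "subspace V" "V \<subseteq> space M"
    and "\<And>i j v. i < m + n \<Longrightarrow> j < m + n \<Longrightarrow> v \<in> V \<Longrightarrow> op i j v \<in> V"
  shows "is_submodule m n M V"
  unfolding is_submodule_def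
proof (intro conjI ballI assms(1,2))
  fix X v assume "X \<in> gl m n" "v \<in> V"
  then show "act M X v \<in> V"
    using assms(2) by (intro act_closed_from_op assms(1,3)) auto
qed

section \<open>Sums of weight spaces\<close>

lemma weight_spaceD:
  assumes "v \<in> weight_space m n M \<mu>"
  shows "v \<in> space M" and "k < m + n \<Longrightarrow> op k k v = scale (\<mu> $ k) v"
  using assms by (auto simp: weight_space_def op_def weight_eval_munit)

text \<open>A diagonal matrix is a combination of diagonal matrix units; \<open>R k\<close> keeps
  its first \<open>k\<close> diagonal entries, and the induction adds them one at a time.\<close>

lemma weight_spaceI:
  assumes v: "v \<in> space M" and eig: "\<And>k. k < m + n \<Longrightarrow> op k k v = scale (\<mu> $ k) v"
  shows "v \<in> weight_space m n M \<mu>"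
proof -
  let ?N = "m + n"
  have "act M h v = scale (weight_eval m n \<mu> h) v" if h: "h \<in> cartan m n" for h
  proof -
    define R where "R k = mat ?N ?N (\<lambda>(i, j). if i < k \<and> i = j then h $$ (i, i) else 0)" for k
    have "act M (R k) v = scale (\<Sum>i<k. \<mu> $ i * h $$ (i, i)) v" if "k \<le> ?N" for k
      using that
    proof (induction k)
      case 0
      have "R 0 = 0\<^sub>m ?N ?N"
        by (auto simp: R_def)
      then show ?case
        using act_mat_zero[OF v] by simp
    next
      case (Suc k)
      have "R (Suc k) = R k + h $$ (k, k) \<cdot>\<^sub>m munit ?N k k"
        by (intro eq_matI) (auto simp: R_def munit_def less_Suc_eq)
      moreover have "R k \<in> gl m n"
        by (simp add: R_def gl_def)
      moreover have "h $$ (k, k) \<cdot>\<^sub>m munit ?N k k \<in> gl m n"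
        by (simp add: gl_def)
      ultimately have "act M (R (Suc k)) v = act M (R k) v + scale (h $$ (k, k)) (op k k v)"
        using v by (simp add: act_mat_add act_mat_smult op_def)
      then show ?case
        using Suc eig[of k] by (simp add: scale_left_distrib mult.commute)
    qed
    from this[of ?N] have "act M (R ?N) v = scale (weight_eval m n \<mu> h) v"
      by (simp add: weight_eval_def)
    moreover have "R ?N = h"
      using h by (intro eq_matI) (auto simp: R_def cartan_def gl_def diagonal_mat_def)
    ultimately show ?thesis
      by simp
  qed
  then show ?thesis
    using v by (simp add: weight_space_def)
qed

lemma subspace_weight_space: "subspace (weight_space m n M \<mu>)"
proof -
  have h: "h \<in> gl m n" if "h \<in> cartan m n" for h
    using that by (simp add: cartan_def)
  have "act M h 0 = 0" if "h \<in> cartan m n" for h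
    using act_scale[OF h[OF that], of 0 0] subspace_0[OF subspace_space] by simp
  then show ?thesis
    using subspace_space h
    by (simp add: subspace_def weight_space_def act_add act_scale scale_right_distrib
        scale_left_commute)
qed

abbreviation shift :: "nat \<Rightarrow> nat \<Rightarrow> complex vec \<Rightarrow> complex vec" where
  "shift i j \<mu> \<equiv> \<mu> + unit_vec (m + n) i - unit_vec (m + n) j"

lemma comm_sign_diag [simp]: "comm_sign k k i j = 1"
proof -
  have "par k + par k = 0" by (simp add: index_parity_def)
  then show ?thesis by (simp add: comm_sign_def parity_sign_def)
qed

text \<open>The matrix unit at \<open>(i, j)\<close> has weight \<epsilon>_i - \<epsilon>_j under
  the adjoint action, as one sees by commuting the diagonal units past it.\<close>

lemma op_weight_space:
  assumes ij: "i < m + n" "j < m + n" and \<mu>: "\<mu> \<in> carrier_vec (m + n)"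
    and v: "v \<in> weight_space m n M \<mu>"
  shows "op i j v \<in> weight_space m n M (shift i j \<mu>)"
proof (rule weight_spaceI)
  show "op i j v \<in> space M"
    using weight_spaceD(1)[OF v] by simp
next
  fix k assume k: "k < m + n"
  have *: "op k k v = scale (\<mu> $ k) v"
    using weight_spaceD(2)[OF v] k by simp
  have "op k k (op i j v) = op i j (op k k v) + (if k = i then op k j v else 0)
      - (if j = k then op i k v else 0)"
    using op_commute[OF k k ij weight_spaceD(1)[OF v]] by simp
  also have "op i j (op k k v) = scale (\<mu> $ k) (op i j v)"
    using * op_scale weight_spaceD(1)[OF v] by simp
  finally show "op k k (op i j v) = scale (shift i j \<mu> $ k) (op i j v)"
    using k ij \<mu> by (auto simp: scale_left_distrib scale_left_diff_distrib)
qed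

definition wsum :: "complex vec set \<Rightarrow> 'v set" where
  "wsum A = span (\<Union>\<mu>\<in>A. weight_space m n M \<mu>)"

lemma subspace_wsum: "subspace (wsum A)"
  by (simp add: wsum_def)

lemma wsum_mono: "A \<subseteq> B \<Longrightarrow> wsum A \<subseteq> wsum B"
  unfolding wsum_def by (intro span_mono) auto

lemma wsum_subset_space: "wsum A \<subseteq> space M"
  unfolding wsum_def by (intro span_subset_space) (auto dest: weight_spaceD)

lemma wsum_base: "\<mu> \<in> A \<Longrightarrow> v \<in> weight_space m n M \<mu> \<Longrightarrow> v \<in> wsum A"
  unfolding wsum_def by (intro span_base) auto

text \<open>Only shifts that are again weights have to lie in \<open>B\<close>: otherwise the image
  of a weight vector vanishes.\<close>

lemma op_wsum:
  assumes ij: "i < m + n" "j < m + n" and A: "A \<subseteq> weights m n M"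
    and B: "\<And>\<mu>. \<mu> \<in> A \<Longrightarrow> shift i j \<mu> \<in> weights m n M \<Longrightarrow> shift i j \<mu> \<in> B"
    and v: "v \<in> wsum A"
  shows "op i j v \<in> wsum B"
proof (rule op_span[OF _ _ subspace_wsum v[unfolded wsum_def]])
  show "(\<Union>\<mu>\<in>A. weight_space m n M \<mu>) \<subseteq> space M"
    by (auto dest: weight_spaceD)
next
  fix u assume "u \<in> (\<Union>\<mu>\<in>A. weight_space m n M \<mu>)"
  then obtain \<mu> where \<mu>: "\<mu> \<in> A" "u \<in> weight_space m n M \<mu>"
    by auto
  then have "\<mu> \<in> carrier_vec (m + n)"
    using A by (auto simp: weights_def)
  then have *: "op i j u \<in> weight_space m n M (shift i j \<mu>)"
    using op_weight_space[OF ij] \<mu> by auto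
  show "op i j u \<in> wsum B"
  proof (cases "op i j u = 0")
    case True
    then show ?thesis using subspace_0[OF subspace_wsum] by simp
  next
    case False
    then have "shift i j \<mu> \<in> weights m n M"
      using * \<open>\<mu> \<in> carrier_vec (m + n)\<close> by (auto simp: weights_def)
    then show ?thesis
      using wsum_base[OF B[OF \<mu>(1)] *] by simp
  qed
qed

lemma wsum_decompose:
  assumes "v \<in> wsum A"
  shows "\<exists>F f. finite F \<and> F \<subseteq> A \<and> (\<forall>\<mu>. f \<mu> \<in> weight_space m n M \<mu>) \<and> v = (\<Sum>\<mu>\<in>F. f \<mu>)"
proof -
  note sub = subspace_weight_space
  show ?thesis
    using assms unfolding wsum_def
  proof (induction rule: span_induct_alt)
    case base
    show ?case
      by (rule exI[of _ "{}"], rule exI[of _ "\<lambda>_. 0"]) (simp add: subspace_0[OF sub])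
  next
    case (step c x y)
    then obtain F f where F: "finite F" "F \<subseteq> A" "\<And>\<mu>. f \<mu> \<in> weight_space m n M \<mu>"
      "y = (\<Sum>\<mu>\<in>F. f \<mu>)"
      by metis
    from step obtain \<nu> where \<nu>: "\<nu> \<in> A" "x \<in> weight_space m n M \<nu>"
      by auto
    \<comment> \<open>The weight \<open>\<nu>\<close> may or may not belong to \<open>F\<close>
      already; cutting off both families lets them be added over the common index set
      \<open>insert \<nu> F\<close>.\<close>
    define f' where "f' = (\<lambda>\<mu>. if \<mu> \<in> F then f \<mu> else 0)"
    define g where "g = (\<lambda>\<mu>. if \<mu> = \<nu> then scale c x else 0)"
    have "y = (\<Sum>\<mu>\<in>insert \<nu> F. f' \<mu>)"
      using F(1) by (subst F(4), intro sum.mono_neutral_cong_left) (auto simp: f'_def)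
    moreover have "scale c x = (\<Sum>\<mu>\<in>insert \<nu> F. g \<mu>)"
      using F(1) by (simp add: g_def)
    ultimately have "scale c x + y = (\<Sum>\<mu>\<in>insert \<nu> F. g \<mu> + f' \<mu>)"
      by (simp add: sum.distrib)
    moreover have "g \<mu> + f' \<mu> \<in> weight_space m n M \<mu>" for \<mu>
      using F \<nu> by (auto simp: g_def f'_def sub subspace_0 subspace_add subspace_scale)
    ultimately show ?case
      using F(1,2) \<nu>(1) by (intro exI[of _ "insert \<nu> F"] exI[of _ "\<lambda>\<mu>. g \<mu> + f' \<mu>"]) auto
  qed
qed

text \<open>If \<open>\<mu>\<close> were outside \<open>A\<close>, then \<open>v\<close> would have
  two decompositions into weight vectors, one concentrated at \<open>\<mu>\<close> and one supported
  in \<open>A\<close>, against uniqueness.\<close>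

lemma weight_in_wsum:
  assumes ss: "cartan_semisimple m n M"
    and A: "A \<subseteq> carrier_vec (m + n)" and \<mu>: "\<mu> \<in> carrier_vec (m + n)"
    and v: "v \<in> weight_space m n M \<mu>" "v \<noteq> 0" and vA: "v \<in> wsum A"
  shows "\<mu> \<in> A"
proof (rule ccontr)
  assume "\<mu> \<notin> A"
  let ?I = "carrier_vec (m + n) :: complex vec set"
  obtain F f where F: "finite F" "F \<subseteq> A" "\<And>\<mu>. f \<mu> \<in> weight_space m n M \<mu>" "v = (\<Sum>\<mu>\<in>F. f \<mu>)"
    using wsum_decompose[OF vA] by metis
  let ?Q = "\<lambda>f. (\<forall>i\<in>?I. f i \<in> weight_space m n M i) \<and> (\<forall>i. i \<notin> ?I \<longrightarrow> f i = 0) \<and>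
      finite {i. f i \<noteq> 0} \<and> v = (\<Sum>i | f i \<noteq> 0. f i)"
  \<comment> \<open>Both families are set to 0 off their supports, as the uniqueness clause of
    \<open>internal_direct_sum\<close> demands.\<close>
  define g where "g = (\<lambda>\<nu>. if \<nu> \<in> F then f \<nu> else 0)"
  define d where "d = (\<lambda>\<nu>. if \<nu> = \<mu> then v else 0)"
  note sub0 = subspace_0[OF subspace_weight_space]
  have fin: "finite {i. g i \<noteq> 0}"
    by (rule finite_subset[OF _ F(1)]) (auto simp: g_def)
  have "v = (\<Sum>i | g i \<noteq> 0. g i)"
    using F(1) by (subst F(4), intro sum.mono_neutral_cong_right) (auto simp: g_def)
  then have "?Q g"
    using F A fin by (auto simp: g_def sub0)
  moreover have "{i. d i \<noteq> 0} = {\<mu>}"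
    using v by (auto simp: d_def)
  then have "?Q d"
    using v \<mu> by (auto simp: d_def sub0)
  moreover have "\<exists>!f. ?Q f"
    using ss weight_spaceD(1)[OF v(1)] by (simp add: cartan_semisimple_def internal_direct_sum_def)
  ultimately have "g = d"
    by blast
  then have "g \<mu> = v"
    by (simp add: d_def)
  then show False
    using v F(2) \<open>\<mu> \<notin> A\<close> by (auto simp: g_def split: if_splits)
qed

section \<open>Finiteness over the even part\<close>

text \<open>For a subspace \<open>T\<close> this is the image of \<open>T\<close> under the
  enveloping algebra of the even strictly lower triangular matrices.\<close>

inductive_set neg_closure :: "'v set \<Rightarrow> 'v set" for T :: "'v set" where
  base: "v \<in> T \<Longrightarrow> v \<in> neg_closure T"
| add: "v \<in> neg_closure T \<Longrightarrow> w \<in> neg_closure T \<Longrightarrow> v + w \<in> neg_closure T"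
| scale: "v \<in> neg_closure T \<Longrightarrow> scale a v \<in> neg_closure T"
| op: "v \<in> neg_closure T \<Longrightarrow> j < i \<Longrightarrow> i < m + n \<Longrightarrow> par i = par j \<Longrightarrow> op i j v \<in> neg_closure T"

lemma neg_closure_minimal:
  assumes "subspace V" "T \<subseteq> V"
    and "\<And>i j v. j < i \<Longrightarrow> i < m + n \<Longrightarrow> par i = par j \<Longrightarrow> v \<in> V \<Longrightarrow> op i j v \<in> V"
  shows "neg_closure T \<subseteq> V"
proof
  fix v assume "v \<in> neg_closure T"
  then show "v \<in> V"
    by induction (use assms in \<open>auto intro: subspace_add subspace_scale\<close>)
qed

lemma neg_closure_subset_space: "T \<subseteq> space M \<Longrightarrow> neg_closure T \<subseteq> space M"
  by (rule neg_closure_minimal[OF subspace_space]) auto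

lemma subspace_neg_closure: "0 \<in> T \<Longrightarrow> subspace (neg_closure T)"
  by (auto simp: subspace_def intro: neg_closure.intros)

text \<open>If \<open>T\<close> is stable under the upper triangular part of the even subalgebra, then commuting an
  even matrix unit past a lower triangular one shows by induction that no further closure is
  needed to obtain an even submodule.\<close>

lemma neg_closure_even:
  assumes T: "T \<subseteq> space M" "0 \<in> T"
    and pos: "\<And>i j v. i \<le> j \<Longrightarrow> j < m + n \<Longrightarrow> par i = par j \<Longrightarrow> v \<in> T \<Longrightarrow> op i j v \<in> T"
    and v: "v \<in> neg_closure T"
    and kl: "k < m + n" "l < m + n" "par k = par l"
  shows "op k l v \<in> neg_closure T"
  using v kl
proof (induction arbitrary: k l)
  case (base v)
  then show ?case
    using pos[of k l v] by (cases "k \<le> l") (auto intro: neg_closure.intros)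
next
  case (add v w)
  then have "op k l (v + w) = op k l v + op k l w"
    using neg_closure_subset_space[OF T(1)] by (intro op_add) auto
  then show ?case
    using add by (simp add: neg_closure.add)
next
  case (scale v a)
  then have "op k l (scale a v) = scale a (op k l v)"
    using neg_closure_subset_space[OF T(1)] by (intro op_scale) auto
  then show ?case
    using scale by (simp add: neg_closure.scale)
next
  case (op v j i)
  note sub = subspace_neg_closure[OF T(2)]
  have v: "v \<in> space M"
    using op.hyps neg_closure_subset_space[OF T(1)] by auto
  have "op i j (op k l v) \<in> neg_closure T"
    using op by (auto intro: neg_closure.op)
  \<comment> \<open>The correction terms are again even matrix units applied to \<open>v\<close>, so
    the induction hypothesis, general in \<open>k\<close> and \<open>l\<close>, covers them.\<close>
  moreover have "(if l = i then op k j v else 0) \<in> neg_closure T"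
    "(if j = k then op i l v else 0) \<in> neg_closure T"
    using op subspace_0[OF sub] by auto
  moreover have "j < m + n"
    using op.hyps by simp
  ultimately show ?case
    using op.prems op.hyps v sub
    by (subst op_commute) (assumption | intro subspace_add subspace_diff subspace_scale)+
qed

section \<open>Words in odd matrix units\<close>

definition odd_pairs :: "(nat \<times> nat) set" where
  "odd_pairs = {(i, j). i < m + n \<and> j < m + n \<and> par i \<noteq> par j}"

lemma finite_odd_pairs: "finite odd_pairs"
  by (rule finite_subset[of _ "{..<m + n} \<times> {..<m + n}"]) (auto simp: odd_pairs_def)

definition word :: "(nat \<times> nat) list \<Rightarrow> 'v \<Rightarrow> 'v" where
  "word u v = foldr (\<lambda>(i, j). op i j) u v"

lemma word_simps [simp]: "word [] v = v" "word ((i, j) # u) v = op i j (word u v)"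
  by (simp_all add: word_def)

lemma word_closed [simp]: "v \<in> space M \<Longrightarrow> word u v \<in> space M"
  by (induction u) auto

text \<open>The filtration of the module generated by \<open>W\<close> by odd degree, as in the PBW
  theorem over the even subalgebra.\<close>

definition odd_span :: "'v set \<Rightarrow> nat \<Rightarrow> 'v set" where
  "odd_span W d = span {word u w | u w. length u \<le> d \<and> set u \<subseteq> odd_pairs \<and> w \<in> W}"

lemma subspace_odd_span: "subspace (odd_span W d)"
  by (simp add: odd_span_def)

lemma odd_span_mono: "d \<le> d' \<Longrightarrow> odd_span W d \<subseteq> odd_span W d'"
  unfolding odd_span_def by (rule span_mono) (auto intro: le_trans)

lemma odd_span_word:
  "length u \<le> d \<Longrightarrow> set u \<subseteq> odd_pairs \<Longrightarrow> w \<in> W \<Longrightarrow> word u w \<in> odd_span W d"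
  unfolding odd_span_def by (rule span_base) auto

lemma odd_span_induct:
  assumes "v \<in> odd_span W d" "subspace V"
    and "\<And>u w. length u \<le> d \<Longrightarrow> set u \<subseteq> odd_pairs \<Longrightarrow> w \<in> W \<Longrightarrow> word u w \<in> V"
  shows "v \<in> V"
proof -
  have "odd_span W d \<subseteq> V"
    unfolding odd_span_def using assms by (intro span_minimal) auto
  then show ?thesis
    using assms by auto
qed

lemma odd_span_op_induct:
  assumes W: "W \<subseteq> space M" and v: "v \<in> odd_span W d" and V: "subspace V"
    and "\<And>u w. length u \<le> d \<Longrightarrow> set u \<subseteq> odd_pairs \<Longrightarrow> w \<in> W \<Longrightarrow> op i j (word u w) \<in> V"
  shows "op i j v \<in> V"
  by (rule op_span[OF _ _ V v[unfolded odd_span_def]]) (use assms in auto)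

lemma odd_span_odd:
  assumes "W \<subseteq> space M" "(i, j) \<in> odd_pairs" "v \<in> odd_span W d"
  shows "op i j v \<in> odd_span W (Suc d)"
proof (rule odd_span_op_induct[OF assms(1,3) subspace_odd_span])
  fix u w assume "length u \<le> d" "set u \<subseteq> odd_pairs" "w \<in> W"
  then show "op i j (word u w) \<in> odd_span W (Suc d)"
    using odd_span_word[of "(i, j) # u" "Suc d" w W] assms(2) by simp
qed

lemma comm_sign_odd: "par i \<noteq> par j \<Longrightarrow> par k \<noteq> par l \<Longrightarrow> comm_sign i j k l = - 1"
  by (simp add: comm_sign_def parity_sign_def index_parity_def split: if_splits)

lemma par_neq_cancel: "par i \<noteq> par j \<Longrightarrow> par j \<noteq> par k \<Longrightarrow> par i = par k"
  by (auto simp: index_parity_def split: if_splits)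

section \<open>Saturation of the filtration over an even submodule\<close>

context
  fixes W :: "'v set"
  assumes W: "subspace W" "W \<subseteq> space M"
    and even: "\<And>i j v. i < m + n \<Longrightarrow> j < m + n \<Longrightarrow> par i = par j \<Longrightarrow> v \<in> W \<Longrightarrow> op i j v \<in> W"
begin

text \<open>Commuting an even unit past an odd letter leaves at most odd units in place of that
  letter, so the length does not grow.\<close>

lemma word_even:
  assumes "set u \<subseteq> odd_pairs" "w \<in> W" "k < m + n" "l < m + n" "par k = par l"
  shows "op k l (word u w) \<in> odd_span W (length u)"
  using assms
proof (induction u)
  case Nil
  then show ?case
    using even odd_span_word[of "[]" 0 "op k l w" W] by simp
next
  case (Cons y u)
  obtain i j where y: "y = (i, j)" by force
  have ij: "i < m + n" "j < m + n" "par i \<noteq> par j"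
    using Cons.prems y by (auto simp: odd_pairs_def)
  have u: "word u w \<in> odd_span W (length u)"
    using Cons.prems by (intro odd_span_word) auto
  have sp: "word u w \<in> space M"
    using Cons.prems W by auto
  let ?D = "odd_span W (Suc (length u))"
  have "op i j (op k l (word u w)) \<in> ?D"
    using Cons y W by (intro odd_span_odd) auto
  moreover have "(if l = i then op k j (word u w) else 0) \<in> ?D"
    "(if j = k then op i l (word u w) else 0) \<in> ?D"
    using odd_span_odd[OF W(2) _ u] ij Cons.prems subspace_0[OF subspace_odd_span]
    by (auto simp: odd_pairs_def)
  ultimately have "op k l (op i j (word u w)) \<in> ?D"
    by (subst op_commute[OF Cons.prems(3,4) ij(1,2) sp])
      (intro subspace_add subspace_diff subspace_scale subspace_odd_span)
  then show ?case
    by (simp add: y)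
qed

lemma odd_span_even:
  assumes "v \<in> odd_span W d" "k < m + n" "l < m + n" "par k = par l"
  shows "op k l v \<in> odd_span W d"
proof (rule odd_span_op_induct[OF W(2) assms(1) subspace_odd_span])
  fix u w assume "length u \<le> d" "set u \<subseteq> odd_pairs" "w \<in> W"
  then show "op k l (word u w) \<in> odd_span W d"
    using subsetD[OF odd_span_mono word_even] assms(2-4) by simp
qed

text \<open>An odd unit has \<open>i \<noteq> j\<close>, so its superbracket with itself, which acts
  as twice its square, is zero.\<close>

lemma odd_square:
  assumes "(i, j) \<in> odd_pairs" "v \<in> space M"
  shows "op i j (op i j v) = 0"
proof -
  have "i < m + n" "j < m + n" "par i \<noteq> par j" "i \<noteq> j"
    using assms by (auto simp: odd_pairs_def)
  then have "op i j (op i j v) = - op i j (op i j v)"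
    using op_commute[of i j i j v] assms by (simp add: comm_sign_odd)
  then have "scale 2 (op i j (op i j v)) = 0"
    by (metis add.right_inverse scale_one scale_left_distrib one_add_one)
  then show ?thesis
    by simp
qed

text \<open>Modulo shorter words the odd matrix units anticommute, so a repeated letter can be moved
  next to its other occurrence, where it squares to zero.\<close>

lemma word_repeat:
  assumes "y \<in> set u" "set u \<subseteq> odd_pairs" "w \<in> W"
  shows "word (y # u) w \<in> odd_span W (length u)"
  using assms
proof (induction u)
  case Nil
  then show ?case by simp
next
  case (Cons z u)
  obtain i j where y: "y = (i, j)" by force
  obtain k l where z: "z = (k, l)" by force
  have sp: "word u w \<in> space M"
    using Cons.prems W by auto
  have u: "word u w \<in> odd_span W (length u)"
    using Cons.prems by (intro odd_span_word) auto
  let ?D = "odd_span W (Suc (length u))"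
  show ?case
  proof (cases "y = z")
    case True
    then show ?thesis
      using odd_square[of i j "word u w"] y Cons.prems sp subspace_0[OF subspace_odd_span] by auto
  next
    case False
    then have yu: "y \<in> set u"
      using Cons.prems by auto
    have odd: "(i, j) \<in> odd_pairs" "(k, l) \<in> odd_pairs"
      using yu y z Cons.prems by auto
    then have ij: "i < m + n" "j < m + n" "k < m + n" "l < m + n" "par i \<noteq> par j" "par k \<noteq> par l"
      by (auto simp: odd_pairs_def)
    have "op k l (op i j (word u w)) \<in> ?D"
      using Cons yu y odd W by (intro odd_span_odd) auto
    \<comment> \<open>The anticommutator of two odd units consists of even ones, which by
      \<open>odd_span_even\<close> do not lengthen words.\<close>
    moreover have "op i l (word u w) \<in> ?D" if "j = k"
      using odd_span_even[OF u, of i l] par_neq_cancel[of i j l] ij that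
        subsetD[OF odd_span_mono[OF le_SucI[OF order_refl]]] by metis
    then have "(if j = k then op i l (word u w) else 0) \<in> ?D"
      using subspace_0[OF subspace_odd_span] by simp
    moreover have "op k j (word u w) \<in> ?D" if "l = i"
      using odd_span_even[OF u, of k j] par_neq_cancel[of k l j] ij that
        subsetD[OF odd_span_mono[OF le_SucI[OF order_refl]]] by metis
    then have "(if l = i then op k j (word u w) else 0) \<in> ?D"
      using subspace_0[OF subspace_odd_span] by simp
    ultimately have "op i j (op k l (word u w)) \<in> ?D"
      by (subst op_commute[OF ij(1-4) sp])
        (intro subspace_add subspace_diff subspace_scale subspace_odd_span)
    then show ?thesis
      by (simp add: y z)
  qed
qed

text \<open>Letters are stripped from the front until one recurs further on;
  \<open>word_repeat\<close> shortens that suffix, and the stripped letters are put back at a cost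
  of one each.\<close>

lemma word_not_distinct:
  assumes "\<not> distinct u" "set u \<subseteq> odd_pairs" "w \<in> W"
  shows "word u w \<in> odd_span W (length u - 1)"
  using assms
proof (induction u)
  case Nil
  then show ?case by simp
next
  case (Cons y u)
  show ?case
  proof (cases "y \<in> set u")
    case True
    then show ?thesis
      using word_repeat[of y u w] Cons.prems by simp
  next
    case False
    then have nd: "\<not> distinct u" "u \<noteq> []"
      using Cons.prems by auto
    obtain i j where y: "y = (i, j)" by force
    have "op i j (word u w) \<in> odd_span W (Suc (length u - 1))"
      using Cons nd y W by (intro odd_span_odd) auto
    then show ?thesis
      using nd y by simp
  qed
qed

text \<open>A word without repetitions has at most \<open>card odd_pairs\<close> letters, and any
  other word reduces to shorter ones.\<close>

lemma odd_span_saturated: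
  "odd_span W (Suc (card odd_pairs)) \<subseteq> odd_span W (card odd_pairs)"
proof
  fix v assume "v \<in> odd_span W (Suc (card odd_pairs))"
  then show "v \<in> odd_span W (card odd_pairs)"
  proof (rule odd_span_induct[OF _ subspace_odd_span])
    fix u w assume u: "length u \<le> Suc (card odd_pairs)" "set u \<subseteq> odd_pairs" "w \<in> W"
    show "word u w \<in> odd_span W (card odd_pairs)"
    proof (cases "distinct u")
      case True
      then have "length u \<le> card odd_pairs"
        using card_mono[OF finite_odd_pairs u(2)] by (simp add: distinct_card)
      then show ?thesis
        using u by (intro odd_span_word)
    next
      case False
      have "length u - 1 \<le> card odd_pairs"
        using u by simp
      then show ?thesis
        by (rule subsetD[OF odd_span_mono word_not_distinct[OF False u(2,3)]])
    qed
  qed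
qed

lemma odd_span_submodule: "is_submodule m n M (odd_span W (card odd_pairs))"
proof (rule is_submoduleI[OF subspace_odd_span])
  show "odd_span W (card odd_pairs) \<subseteq> space M"
    unfolding odd_span_def using W(2) by (intro span_subset_space) auto
next
  fix i j v assume *: "i < m + n" "j < m + n" "v \<in> odd_span W (card odd_pairs)"
  then show "op i j v \<in> odd_span W (card odd_pairs)"
    using odd_span_even[of v _ i j] odd_span_odd[OF W(2), of i j v] odd_span_saturated
    by (cases "par i = par j") (auto simp: odd_pairs_def)
qed

end

end

section \<open>Block sums and cones\<close>

text \<open>Real parts make inequalities available; for integral weights they are the coordinates
  themselves.\<close>

definition bsum :: "nat set \<Rightarrow> complex vec \<Rightarrow> real" where
  "bsum B \<mu> = (\<Sum>a\<in>B. Re (\<mu> $ a))"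

lemma bsum_insert: "finite B \<Longrightarrow> a \<notin> B \<Longrightarrow> bsum (insert a B) \<mu> = Re (\<mu> $ a) + bsum B \<mu>"
  by (simp add: bsum_def)

lemma bsum_unit_diff:
  assumes "B \<subseteq> {..<N}" "i < N" "j < N"
  shows "bsum B (unit_vec N i - unit_vec N j) = of_bool (i \<in> B) - of_bool (j \<in> B)"
proof -
  have fin: "finite B"
    using assms(1) by (rule finite_subset) simp
  have "bsum B (unit_vec N i - unit_vec N j) =
      (\<Sum>a\<in>B. (if a = i then 1 else 0) - (if a = j then 1 else 0))"
    unfolding bsum_def using assms by (intro sum.cong) auto
  also have "\<dots> = of_bool (i \<in> B) - of_bool (j \<in> B)"
    using fin by (simp add: sum_subtractf)
  finally show ?thesis .
qed

lemma bsum_shift: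
  assumes "B \<subseteq> {..<N}" "i < N" "j < N" "\<mu> \<in> carrier_vec N"
  shows "bsum B (\<mu> + unit_vec N i - unit_vec N j) =
    bsum B \<mu> + of_bool (i \<in> B) - of_bool (j \<in> B)"
proof -
  have "bsum B (\<mu> + unit_vec N i - unit_vec N j) =
      bsum B \<mu> + bsum B (unit_vec N i - unit_vec N j)"
    unfolding bsum_def sum.distrib[symmetric] using assms by (intro sum.cong) auto
  then show ?thesis
    using bsum_unit_diff[OF assms(1-3)] by simp
qed

text \<open>Initial segments of the even and of the odd indices. Their indicator vectors pair
  nonnegatively with every even positive root, which is the content of
  \<open>blocks_downward_closed\<close>.\<close>

definition blocks :: "nat \<Rightarrow> nat \<Rightarrow> nat set set" where
  "blocks m n = (\<lambda>k. {..<k}) ` {..m} \<union> (\<lambda>l. {m..<m + l}) ` {..n}"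

lemma finite_blocks: "finite (blocks m n)"
  by (simp add: blocks_def)

lemma blocks_subset: "B \<in> blocks m n \<Longrightarrow> B \<subseteq> {..<m + n}"
  by (auto simp: blocks_def)

lemma blocks_downward_closed:
  "B \<in> blocks m n \<Longrightarrow> i \<in> B \<Longrightarrow> j \<le> i \<Longrightarrow> index_parity m i = index_parity m j \<Longrightarrow> j \<in> B"
  by (auto simp: blocks_def index_parity_def split: if_splits)

text \<open>A discrete intermediate value theorem.\<close>

lemma steps_attain:
  fixes f :: "nat \<Rightarrow> nat"
  assumes "f 0 = 0" "\<And>r. f (Suc r) \<le> Suc (f r)" "k \<le> f N"
  shows "\<exists>r\<le>N. f r = k"
  using assms(3)
proof (induction N)
  case 0
  then show ?case using assms(1) by auto
next
  case (Suc N)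
  show ?case
  proof (cases "k \<le> f N")
    case True
    then show ?thesis using Suc by (meson le_SucI)
  next
    case False
    then have "f (Suc N) = k" using Suc.prems assms(2)[of N] by simp
    then show ?thesis by blast
  qed
qed

section \<open>Prefixes of a 0-1 sequence\<close>

locale seq01 =
  fixes m n :: nat and b :: "nat list"
  assumes seq: "is_01_sequence m n b"
begin

definition cnt :: "nat \<Rightarrow> nat \<Rightarrow> nat" where
  "cnt x r = card {j. j < r \<and> b ! j = x}"

text \<open>The permutation matching positions in \<open>b\<close> with standard coordinates; see
  \<open>eps_eq\<close>.\<close>

definition idx :: "nat \<Rightarrow> nat" where
  "idx i = (if b ! i = 0 then cnt 0 i else m + cnt 1 i)"

text \<open>The coordinates met in the first \<open>r\<close> positions, as
  \<open>prefix_set_image\<close> shows. Writing them through counts displays the set as an even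
  block together with an odd one.\<close>

definition prefix_set :: "nat \<Rightarrow> nat set" where
  "prefix_set r = {..<cnt 0 r} \<union> {m..<m + cnt 1 r}"

lemma eps_eq: "eps m n b i = unit_vec (m + n) (idx i)"
  by (simp add: eps_def idx_def cnt_def)

lemma cnt_0 [simp]: "cnt x 0 = 0"
  by (simp add: cnt_def)

lemma cnt_Suc: "cnt x (Suc r) = cnt x r + (if b ! r = x then 1 else 0)"
proof -
  have "{j. j < Suc r \<and> b ! j = x} = {j. j < r \<and> b ! j = x} \<union> (if b ! r = x then {r} else {})"
    by (auto simp: less_Suc_eq)
  then show ?thesis
    by (simp add: cnt_def card_insert_if)
qed

lemma cnt_mono: "r \<le> s \<Longrightarrow> cnt x r \<le> cnt x s"
  by (rule lift_Suc_mono_le[of "cnt x"]) (simp_all add: cnt_Suc)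

lemma cnt_full: "cnt 0 (m + n) = m" "cnt 1 (m + n) = n"
proof -
  have "count_list b x = cnt x (m + n)" for x
  proof -
    have "{j. j < m + n \<and> b ! j = x} = {j. j < length b \<and> x = b ! j}"
      using seq by (auto simp: is_01_sequence_def)
    then show ?thesis
      by (simp add: cnt_def count_list_eq_length_filter length_filter_conv_card)
  qed
  then show "cnt 0 (m + n) = m" "cnt 1 (m + n) = n"
    using seq unfolding is_01_sequence_def by metis+
qed

lemma cnt_le: "r \<le> m + n \<Longrightarrow> cnt 0 r \<le> m" "r \<le> m + n \<Longrightarrow> cnt 1 r \<le> n"
  using cnt_mono[of r "m + n"] cnt_full by metis+

text \<open>The \<open>m\<close> zeros and \<open>n\<close> ones already fill all
  \<open>m + n\<close> positions.\<close>

lemma entry_cases: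
  assumes "i < m + n"
  shows "b ! i = 0 \<or> b ! i = 1"
proof -
  have "card ({j. j < m + n \<and> b ! j = 0} \<union> {j. j < m + n \<and> b ! j = 1}) = m + n"
    using cnt_full by (subst card_Un_disjoint) (auto simp: cnt_def)
  then have "{j. j < m + n \<and> b ! j = 0} \<union> {j. j < m + n \<and> b ! j = 1} = {..<m + n}"
    by (intro card_subset_eq) auto
  then show ?thesis
    using assms by blast
qed

lemma prefix_set_0 [simp]: "prefix_set 0 = {}"
  by (simp add: prefix_set_def)

lemma prefix_set_full: "prefix_set (m + n) = {..<m + n}"
  unfolding prefix_set_def cnt_full by auto

lemma finite_prefix_set: "finite (prefix_set r)"
  by (simp add: prefix_set_def)

lemma prefix_set_Suc:
  assumes "r < m + n"
  shows "prefix_set (Suc r) = insert (idx r) (prefix_set r)" "idx r \<notin> prefix_set r"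
  using entry_cases[OF assms] cnt_le[of "Suc r"] assms
  by (auto simp: prefix_set_def idx_def cnt_Suc)

lemma prefix_set_image: "r \<le> m + n \<Longrightarrow> prefix_set r = idx ` {..<r}"
  by (induction r) (auto simp: prefix_set_Suc lessThan_Suc)

lemma idx_inj: "inj_on idx {..<m + n}"
proof (rule linorder_inj_onI)
  fix r s assume "r < s" "r \<in> {..<m + n}" "s \<in> {..<m + n}"
  then show "idx r \<noteq> idx s"
    using prefix_set_Suc(2)[of s] prefix_set_image[of s] by (metis image_eqI lessThan_iff less_imp_le)
qed auto

lemma idx_eq_iff: "i < m + n \<Longrightarrow> j < m + n \<Longrightarrow> idx i = idx j \<longleftrightarrow> i = j"
  using idx_inj by (auto simp: inj_on_def)

lemma idx_image: "idx ` {..<m + n} = {..<m + n}"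
  using prefix_set_full prefix_set_image[of "m + n"] by simp

lemma idx_less: "i < m + n \<Longrightarrow> idx i < m + n"
  using idx_image by blast

lemma idx_in_prefix_set: "i < m + n \<Longrightarrow> r \<le> m + n \<Longrightarrow> idx i \<in> prefix_set r \<longleftrightarrow> i < r"
  by (auto simp: prefix_set_image idx_eq_iff)

lemma prefix_set_subset: "r \<le> m + n \<Longrightarrow> prefix_set r \<subseteq> {..<m + n}"
  using idx_less by (auto simp: prefix_set_image)

lemma bsum_prefix_set:
  "r \<le> m + n \<Longrightarrow> bsum (prefix_set r) \<mu> = bsum {..<cnt 0 r} \<mu> + bsum {m..<m + cnt 1 r} \<mu>"
  unfolding prefix_set_def bsum_def using cnt_le[of r] by (intro sum.union_disjoint) auto

lemma bsum_prefix_Suc: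
  "r < m + n \<Longrightarrow> bsum (prefix_set (Suc r)) \<mu> = bsum (prefix_set r) \<mu> + Re (\<mu> $ idx r)"
  using prefix_set_Suc[of r] finite_prefix_set[of r] by (simp add: bsum_insert)

text \<open>Both counters start at 0, grow by at most one per position and end at \<open>m\<close>
  and \<open>n\<close>, so every block is the even or the odd half of some prefix set.\<close>

lemma blocks_attained:
  assumes "B \<in> blocks m n"
  obtains r where "r \<le> m + n" "B = {..<cnt 0 r} \<or> B = {m..<m + cnt 1 r}"
proof -
  have "\<exists>r\<le>m + n. B = {..<cnt 0 r} \<or> B = {m..<m + cnt 1 r}"
    using assms unfolding blocks_def
  proof
    assume "B \<in> (\<lambda>k. {..<k}) ` {..m}"
    then obtain k where k: "k \<le> m" "B = {..<k}" by auto
    then show ?thesis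
      using steps_attain[of "cnt 0" k "m + n"] by (fastforce simp: cnt_Suc cnt_full)
  next
    assume "B \<in> (\<lambda>l. {m..<m + l}) ` {..n}"
    then obtain l where l: "l \<le> n" "B = {m..<m + l}" by auto
    then show ?thesis
      using steps_attain[of "cnt 1" l "m + n"] cnt_full(2) by (fastforce simp: cnt_Suc)
  qed
  then show ?thesis using that by blast
qed

lemma cnt_blocks: "r \<le> m + n \<Longrightarrow> {..<cnt 0 r} \<in> blocks m n \<and> {m..<m + cnt 1 r} \<in> blocks m n"
  using cnt_le[of r] by (auto simp: blocks_def)

section \<open>Prefix sums and cones of simple roots\<close>

definition sroot :: "nat \<Rightarrow> complex vec" where
  "sroot j = eps m n b j - eps m n b (j + 1)"

lemma simple_roots_eq: "simple_roots m n b = sroot ` {j. Suc j < m + n}"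
  by (auto simp: simple_roots_def sroot_def)

lemma sroot_index:
  "Suc j < m + n \<Longrightarrow> s < m + n \<Longrightarrow> sroot j $ idx s = of_bool (j = s) - of_bool (Suc j = s)"
  by (simp add: sroot_def eps_eq idx_less idx_eq_iff)

text \<open>The entry 1 of \<open>sroot k\<close> occurs only at coordinate \<open>idx k\<close>.
  This allows sums over the set of simple roots to be taken over positions.\<close>

lemma inj_sroot: "inj_on sroot {j. Suc j < m + n}"
proof (rule inj_onI)
  fix j k assume *: "j \<in> {j. Suc j < m + n}" "k \<in> {j. Suc j < m + n}" "sroot j = sroot k"
  then have "sroot k $ idx j = 1"
    using sroot_index[of j j] by simp
  then have "of_bool (k = j) - of_bool (Suc k = j) = (1 :: complex)"
    using sroot_index[of k j] * by simp
  then show "j = k"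
    by (cases "k = j"; cases "Suc k = j") simp_all
qed

text \<open>The value is 1 for \<open>r = Suc j\<close> and 0 otherwise: prefix sums are dual to the
  simple roots.\<close>

lemma bsum_prefix_sroot:
  assumes "Suc j < m + n" "r \<le> m + n"
  shows "bsum (prefix_set r) (sroot j) = of_bool (j < r) - of_bool (Suc j < r)"
  using assms by (simp add: sroot_def eps_eq bsum_unit_diff prefix_set_subset idx_less
      idx_in_prefix_set)

text \<open>By this duality, subtracting \<open>sroot j\<close> lowers only the prefix sum at
  \<open>Suc j\<close>, and \<open>Suc j < m + n\<close> leaves the total alone.\<close>

lemma lower_cone_prefix:
  assumes "\<mu> \<in> lower_cone m n b l" "r \<le> m + n"
  shows "bsum (prefix_set r) \<mu> \<le> bsum (prefix_set r) l"
    and "r = m + n \<Longrightarrow> bsum (prefix_set r) \<mu> = bsum (prefix_set r) l"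
proof -
  obtain c :: "complex vec \<Rightarrow> nat" where
    c: "\<mu> = vec (m + n) (\<lambda>i. l $ i - (\<Sum>\<alpha>\<in>simple_roots m n b. of_nat (c \<alpha>) * \<alpha> $ i))"
    using assms(1) by (auto simp: lower_cone_def)
  have "bsum (prefix_set r) \<mu> = (\<Sum>a\<in>prefix_set r. Re (l $ a) -
      (\<Sum>\<alpha>\<in>simple_roots m n b. real (c \<alpha>) * Re (\<alpha> $ a)))"
    unfolding bsum_def c using prefix_set_subset[OF assms(2)] by (intro sum.cong) auto
  also have "\<dots> = bsum (prefix_set r) l -
      (\<Sum>a\<in>prefix_set r. \<Sum>\<alpha>\<in>simple_roots m n b. real (c \<alpha>) * Re (\<alpha> $ a))"
    by (simp add: sum_subtractf bsum_def)
  also have "(\<Sum>a\<in>prefix_set r. \<Sum>\<alpha>\<in>simple_roots m n b. real (c \<alpha>) * Re (\<alpha> $ a)) =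
      (\<Sum>\<alpha>\<in>simple_roots m n b. real (c \<alpha>) * bsum (prefix_set r) \<alpha>)"
    by (subst sum.swap) (simp add: bsum_def sum_distrib_left)
  finally have eq: "bsum (prefix_set r) \<mu> = bsum (prefix_set r) l -
      (\<Sum>\<alpha>\<in>simple_roots m n b. real (c \<alpha>) * bsum (prefix_set r) \<alpha>)" .
  have "bsum (prefix_set r) \<alpha> \<ge> 0" if "\<alpha> \<in> simple_roots m n b" for \<alpha>
    using that assms(2) by (auto simp: simple_roots_eq bsum_prefix_sroot)
  then show "bsum (prefix_set r) \<mu> \<le> bsum (prefix_set r) l"
    unfolding eq by (simp add: sum_nonneg)
  have "bsum (prefix_set r) \<alpha> = 0" if "\<alpha> \<in> simple_roots m n b" "r = m + n" for \<alpha>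
    using that assms(2) by (auto simp: simple_roots_eq bsum_prefix_sroot)
  then show "bsum (prefix_set r) \<mu> = bsum (prefix_set r) l" if "r = m + n"
    unfolding eq using that by simp
qed

lemma Re_Ints: "z \<in> \<int> \<Longrightarrow> Re z \<in> \<int>"
  by (auto elim: Ints_cases)

lemma bsum_Ints: "\<mu> \<in> integral_weights m n \<Longrightarrow> B \<subseteq> {..<m + n} \<Longrightarrow> bsum B \<mu> \<in> \<int>"
  unfolding bsum_def integral_weights_def by (intro Ints_sum) (auto intro: Re_Ints)

text \<open>The coefficient of the \<open>j\<close>-th simple root in \<open>l - \<mu>\<close> is the difference of the sums over the
  first \<open>j + 1\<close> positions.\<close>

lemma lower_coneI:
  assumes \<mu>: "\<mu> \<in> integral_weights m n" and l: "l \<in> integral_weights m n"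
    and le: "\<And>r. r \<le> m + n \<Longrightarrow> bsum (prefix_set r) \<mu> \<le> bsum (prefix_set r) l"
    and eq: "bsum (prefix_set (m + n)) \<mu> = bsum (prefix_set (m + n)) l"
  shows "\<mu> \<in> lower_cone m n b l"
proof -
  let ?N = "m + n" and ?J = "{j. Suc j < m + n}"
  define d where "d r = bsum (prefix_set r) l - bsum (prefix_set r) \<mu>" for r
  \<comment> \<open>\<open>the_inv_into\<close> recovers \<open>j\<close> from
    \<open>sroot j\<close>. Taking \<open>nat\<close> of the floor loses nothing, as
    \<open>d\<close> is integral and, by \<open>le\<close>, nonnegative up to
    \<open>m + n\<close>.\<close>
  define c where "c \<alpha> = nat \<lfloor>d (Suc (the_inv_into ?J sroot \<alpha>))\<rfloor>" for \<alpha>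
  have d: "real (nat \<lfloor>d r\<rfloor>) = d r" if "r \<le> ?N" for r
  proof -
    have "d r \<in> \<int>"
      unfolding d_def using \<mu> l prefix_set_subset[OF that] by (intro Ints_diff bsum_Ints)
    then show ?thesis
      using le[OF that] by (auto simp: d_def elim!: Ints_cases)
  qed
  have "finite ?J"
    by (rule finite_subset[of _ "{..<?N}"]) auto
  have "\<mu> $ i = l $ i - (\<Sum>\<alpha>\<in>simple_roots m n b. of_nat (c \<alpha>) * \<alpha> $ i)" if "i < ?N" for i
  proof -
    have "i \<in> idx ` {..<?N}"
      using that idx_image by simp
    then obtain s where s: "s < ?N" "i = idx s"
      by auto
    have "(\<Sum>\<alpha>\<in>simple_roots m n b. of_nat (c \<alpha>) * \<alpha> $ i) =
        (\<Sum>j\<in>?J. of_nat (c (sroot j)) * sroot j $ i)"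
      unfolding simple_roots_eq by (subst sum.reindex[OF inj_sroot]) simp
    also have "\<dots> = (\<Sum>j\<in>?J. of_real (d (Suc j)) * (of_bool (j = s) - of_bool (Suc j = s)))"
    proof (intro sum.cong refl)
      fix j assume j: "j \<in> ?J"
      have "complex_of_real (real (c (sroot j))) = of_real (d (Suc j))"
        using j d[of "Suc j"] the_inv_into_f_f[OF inj_sroot j] by (simp add: c_def)
      then show "of_nat (c (sroot j)) * sroot j $ i =
          complex_of_real (d (Suc j)) * (of_bool (j = s) - of_bool (Suc j = s))"
        using sroot_index[of j s] j s by simp
    qed
    \<comment> \<open>Only the roots starting or ending at position \<open>s\<close> contribute, so
      the sum collapses to \<open>d (Suc s) - d s\<close>.\<close>
    also have "\<dots> = (\<Sum>j\<in>?J. if j = s then complex_of_real (d (Suc j)) else 0) -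
        (\<Sum>j\<in>?J. if Suc j = s then of_real (d (Suc j)) else 0)"
      unfolding sum_subtractf[symmetric] by (intro sum.cong) auto
    also have "(\<Sum>j\<in>?J. if j = s then complex_of_real (d (Suc j)) else 0) = of_real (d (Suc s))"
    proof (cases "Suc s < ?N")
      \<comment> \<open>No simple root starts at the last position: the sum is 0, and so is
        \<open>d (m + n)\<close> by \<open>eq\<close>. For \<open>s = 0\<close> below,
        \<open>d 0\<close> vanishes as an empty sum.\<close>
      case False
      then have "Suc s = ?N" using s by simp
      then show ?thesis using eq \<open>finite ?J\<close> by (simp add: d_def)
    qed (use \<open>finite ?J\<close> in simp)
    also have "(\<Sum>j\<in>?J. if Suc j = s then complex_of_real (d (Suc j)) else 0) = of_real (d s)"
    proof (cases s)
      case 0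
      then show ?thesis by (simp add: d_def bsum_def)
    next
      case (Suc t)
      then have "t \<in> ?J" using s by simp
      then show ?thesis using Suc \<open>finite ?J\<close> by simp
    qed
    also have "complex_of_real (d (Suc s)) - of_real (d s) = of_real (Re (l $ i) - Re (\<mu> $ i))"
      using s by (simp add: d_def bsum_prefix_Suc)
    also have "\<dots> = l $ i - \<mu> $ i"
    proof -
      have "l $ i \<in> \<int>" "\<mu> $ i \<in> \<int>"
        using \<mu> l that by (simp_all add: integral_weights_def)
      then show ?thesis
        by (auto elim!: Ints_cases)
    qed
    finally show ?thesis by simp
  qed
  then have "\<mu> = vec ?N (\<lambda>i. l $ i - (\<Sum>\<alpha>\<in>simple_roots m n b. of_nat (c \<alpha>) * \<alpha> $ i))"
    using \<mu> by (intro eq_vecI) (auto simp: integral_weights_def)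
  then show ?thesis
    unfolding lower_cone_def by blast
qed

text \<open>The total is constant on a cone and takes only finitely many integer values on
  \<open>A\<close>. One apex per value suffices, with all proper nonempty prefix sums equal to the
  ceiling of \<open>C\<close>.\<close>

lemma finite_cones:
  assumes A: "A \<subseteq> integral_weights m n"
    and ub: "\<And>\<mu> r. \<mu> \<in> A \<Longrightarrow> r \<le> m + n \<Longrightarrow> bsum (prefix_set r) \<mu> \<le> C"
    and lb: "\<And>\<mu>. \<mu> \<in> A \<Longrightarrow> - C \<le> bsum {..<m + n} \<mu>"
  shows "\<exists>L. finite L \<and> L \<subseteq> integral_weights m n \<and> (\<forall>\<mu>\<in>A. \<exists>l\<in>L. \<mu> \<in> lower_cone m n b l)"
proof -
  let ?N = "m + n"
  define K where "K = \<lceil>C\<rceil>"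
  \<comment> \<open>\<open>D t r\<close> prescribes the prefix sums of the apex
    \<open>lam t\<close>, whose coordinates are their differences. Testing \<open>r = 0\<close>
    first keeps the empty prefix at 0 even if \<open>m + n = 0\<close>.\<close>
  define D :: "int \<Rightarrow> nat \<Rightarrow> int" where "D t r = (if r = 0 then 0 else if r = ?N then t else K)" for t r
  define lam where "lam t = vec ?N (\<lambda>i. complex_of_int
    (D t (Suc (the_inv_into {..<?N} idx i)) - D t (the_inv_into {..<?N} idx i)))" for t
  have int: "lam t \<in> integral_weights m n" for t
    by (auto simp: lam_def integral_weights_def)
  have lam_idx: "lam t $ idx s = of_int (D t (Suc s) - D t s)" if "s < ?N" for t s
    using that idx_less by (simp add: lam_def the_inv_into_f_f[OF idx_inj])
  have pre: "bsum (prefix_set r) (lam t) = D t r" if "r \<le> ?N" for t r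
    using that
  proof (induction r)
    case 0
    then show ?case by (simp add: bsum_def D_def)
  next
    case (Suc r)
    then show ?case by (simp add: bsum_prefix_Suc lam_idx)
  qed
  have "\<exists>l\<in>lam ` {-K..K}. \<mu> \<in> lower_cone m n b l" if \<mu>: "\<mu> \<in> A" for \<mu>
  proof -
    obtain t where t: "bsum {..<?N} \<mu> = of_int t"
      using bsum_Ints[of \<mu> "{..<?N}"] A \<mu> by (auto elim: Ints_cases)
    have "of_int t \<le> C" "- C \<le> of_int t"
      using ub[OF \<mu>, of ?N] lb[OF \<mu>] t by (simp_all add: prefix_set_full)
    then have tK: "t \<in> {-K..K}"
      unfolding K_def by (simp add: le_ceiling_iff minus_le_iff)
    have "\<mu> \<in> lower_cone m n b (lam t)"
    proof (rule lower_coneI)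
      show tot: "bsum (prefix_set ?N) \<mu> = bsum (prefix_set ?N) (lam t)"
      proof (cases "?N = 0")
        case True
        then show ?thesis unfolding prefix_set_full by (simp add: bsum_def)
      next
        case False
        then show ?thesis using pre[of ?N t] t by (auto simp: prefix_set_full D_def)
      qed
      fix r assume r: "r \<le> ?N"
      show "bsum (prefix_set r) \<mu> \<le> bsum (prefix_set r) (lam t)"
      proof (cases "r = 0 \<or> r = ?N")
        case True
        then show ?thesis using tot by (auto simp: bsum_def)
      next
        case False
        then have "bsum (prefix_set r) (lam t) = K"
          using pre[OF r] by (simp add: D_def)
        then show ?thesis
          using order_trans[OF ub[OF \<mu> r] le_of_int_ceiling] by (simp add: K_def)
      qed
    qed (use A \<mu> int in auto)
    then show ?thesis using tK by blast
  qed
  then show ?thesis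
    using int by (intro exI[of _ "lam ` {-K..K}"]) auto
qed

end

section \<open>Bounds on the weights\<close>

context gl_module
begin

definition bounded_weights :: "real \<Rightarrow> complex vec set" where
  "bounded_weights c = {\<mu> \<in> weights m n M. \<forall>B\<in>blocks m n. bsum B \<mu> \<le> c}"

lemma weights_carrier: "weights m n M \<subseteq> carrier_vec (m + n)"
  by (auto simp: weights_def)

text \<open>Stated for general \<open>I\<close> to serve both direct sum conditions, over all
  weights and over the integral ones.\<close>

lemma space_decompose:
  assumes ss: "internal_direct_sum (space M) I (weight_space m n M)" "I \<subseteq> carrier_vec (m + n)"
    and v: "v \<in> space M"
  shows "\<exists>F. finite F \<and> F \<subseteq> weights m n M \<inter> I \<and> v \<in> wsum F"
proof -
  obtain f where f: "\<forall>\<mu>\<in>I. f \<mu> \<in> weight_space m n M \<mu>" "\<forall>\<mu>. \<mu> \<notin> I \<longrightarrow> f \<mu> = 0"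
    "finite {\<mu>. f \<mu> \<noteq> 0}" "v = (\<Sum>\<mu> | f \<mu> \<noteq> 0. f \<mu>)"
    using ss(1) v unfolding internal_direct_sum_def by metis
  define F where "F = {\<mu>. f \<mu> \<noteq> 0}"
  have F: "\<mu> \<in> I" "f \<mu> \<in> weight_space m n M \<mu>" "f \<mu> \<noteq> 0" if "\<mu> \<in> F" for \<mu>
    using f(1,2) that by (auto simp: F_def)
  have "F \<subseteq> weights m n M \<inter> I"
    using F ss(2) unfolding weights_def by fastforce
  moreover have "v \<in> wsum F"
    unfolding f(4) F_def[symmetric] using F by (intro subspace_sum subspace_wsum) (auto intro: wsum_base)
  ultimately show ?thesis
    using f(3) F_def by blast
qed

lemma weights_subset_if_space:
  assumes "cartan_semisimple m n M" "A \<subseteq> carrier_vec (m + n)" "space M \<subseteq> wsum A"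
  shows "weights m n M \<subseteq> A"
proof
  fix \<mu> assume \<mu>: "\<mu> \<in> weights m n M"
  have "0 \<in> weight_space m n M \<mu>"
    using subspace_0[OF subspace_weight_space] .
  then obtain v where "v \<in> weight_space m n M \<mu>" "v \<noteq> 0"
    using \<mu> unfolding weights_def by blast
  then show "\<mu> \<in> A"
    using weight_in_wsum[OF assms(1,2)] \<mu> weights_carrier weight_spaceD(1) assms(3) by blast
qed

text \<open>A matrix unit changes each block sum by at most 1. An even lowering one never increases
  it, because a block containing \<open>i\<close> also contains \<open>j\<close>.\<close>

lemma op_bounded_weights:
  assumes ij: "i < m + n" "j < m + n" and v: "v \<in> wsum (bounded_weights c)"
  shows "op i j v \<in> wsum (bounded_weights (c + 1))"
    and "par i = par j \<Longrightarrow> j < i \<Longrightarrow> op i j v \<in> wsum (bounded_weights c)"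
proof -
  have sub: "bounded_weights c \<subseteq> weights m n M"
    by (auto simp: bounded_weights_def)
  have sh: "bsum B (shift i j \<mu>) = bsum B \<mu> + of_bool (i \<in> B) - of_bool (j \<in> B)"
    if "\<mu> \<in> bounded_weights c" "B \<in> blocks m n" for \<mu> B
    using bsum_shift[OF blocks_subset[OF that(2)] ij] sub that(1) weights_carrier by auto
  have le: "bsum B \<mu> \<le> c" if "\<mu> \<in> bounded_weights c" "B \<in> blocks m n" for \<mu> B
    using that by (simp add: bounded_weights_def)
  show "op i j v \<in> wsum (bounded_weights (c + 1))"
  proof (rule op_wsum[OF ij sub _ v])
    fix \<mu> assume \<mu>: "\<mu> \<in> bounded_weights c" "shift i j \<mu> \<in> weights m n M"
    have "bsum B (shift i j \<mu>) \<le> c + 1" if "B \<in> blocks m n" for B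
      using sh[OF \<mu>(1) that] le[OF \<mu>(1) that] by (simp add: of_bool_def split: if_splits)
    then show "shift i j \<mu> \<in> bounded_weights (c + 1)"
      using \<mu>(2) by (simp add: bounded_weights_def)
  qed
  show "op i j v \<in> wsum (bounded_weights c)" if "par i = par j" "j < i"
  proof (rule op_wsum[OF ij sub _ v])
    fix \<mu> assume \<mu>: "\<mu> \<in> bounded_weights c" "shift i j \<mu> \<in> weights m n M"
    have "bsum B (shift i j \<mu>) \<le> c" if B: "B \<in> blocks m n" for B
      using sh[OF \<mu>(1) B] le[OF \<mu>(1) B] blocks_downward_closed[OF B, of i j]
        \<open>par i = par j\<close> \<open>j < i\<close>
      by (cases "i \<in> B"; cases "j \<in> B") simp_all
    then show "shift i j \<mu> \<in> bounded_weights c"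
      using \<mu>(2) by (simp add: bounded_weights_def)
  qed
qed

lemma odd_span_bounded:
  assumes "W \<subseteq> wsum (bounded_weights c)"
  shows "odd_span W d \<subseteq> wsum (bounded_weights (c + real d))"
proof
  fix v assume "v \<in> odd_span W d"
  then show "v \<in> wsum (bounded_weights (c + real d))"
  proof (rule odd_span_induct[OF _ subspace_wsum])
    fix u w assume u: "length u \<le> d" "set u \<subseteq> odd_pairs" "w \<in> W"
    have "word u w \<in> wsum (bounded_weights (c + real (length u)))"
      using u(2)
    proof (induction u)
      case Nil
      then show ?case using assms u(3) by auto
    next
      case (Cons y u)
      obtain i j where y: "y = (i, j)" by force
      then have "i < m + n" "j < m + n"
        using Cons.prems by (auto simp: odd_pairs_def)
      then show ?case
        using op_bounded_weights(1)[of i j "word u w" "c + real (length u)"] Cons y by (simp add: algebra_simps)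
    qed
    moreover have "bounded_weights (c + real (length u)) \<subseteq> bounded_weights (c + real d)"
      using u(1) by (fastforce simp: bounded_weights_def)
    ultimately show "word u w \<in> wsum (bounded_weights (c + real d))"
      using wsum_mono by blast
  qed
qed

text \<open>A prefix sum along \<open>b\<close> is the sum of an even and an odd block sum, so a lower bound on all
  block sums together with the upper bound on the prefix sums bounds the block sums from above.\<close>

lemma block_sums_bounded:
  assumes seq: "seq01 m n b" and ss: "cartan_semisimple m n M" and fg: "finitely_generated m n M"
    and ub: "\<And>\<mu> r. \<mu> \<in> weights m n M \<Longrightarrow> r \<le> m + n \<Longrightarrow> bsum (seq01.prefix_set m b r) \<mu> \<le> C"
  shows "\<exists>c. weights m n M \<subseteq> bounded_weights c"
proof -
  interpret seq01 m n b by (rule seq)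
  obtain S where S: "finite S" "S \<subseteq> space M"
    "\<forall>W. is_submodule m n M W \<and> S \<subseteq> W \<longrightarrow> W = space M"
    using fg unfolding finitely_generated_def by (elim exE conjE)
  have "\<forall>s\<in>S. \<exists>F. finite F \<and> F \<subseteq> weights m n M \<and> s \<in> wsum F"
    using space_decompose[OF ss[unfolded cartan_semisimple_def] order_refl] S(2)
    by (meson le_inf_iff subsetD)
  then obtain F where F: "\<forall>s\<in>S. finite (F s) \<and> F s \<subseteq> weights m n M \<and> s \<in> wsum (F s)"
    by metis
  define G where "G = (\<Union>s\<in>S. F s)"
  have G: "finite G" "G \<subseteq> weights m n M"
    using F S(1) by (auto simp: G_def)
  \<comment> \<open>A crude uniform bound for the block sums of the finitely many weights occurring
    in the generators.\<close>
  define K where "K = (\<Sum>\<mu>\<in>G. \<Sum>B\<in>blocks m n. \<bar>bsum B \<mu>\<bar>)"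
  have K: "- K \<le> bsum B \<mu>" if "\<mu> \<in> G" "B \<in> blocks m n" for B \<mu>
  proof -
    have "\<bar>bsum B \<mu>\<bar> \<le> (\<Sum>B\<in>blocks m n. \<bar>bsum B \<mu>\<bar>)"
      using that finite_blocks by (intro member_le_sum) auto
    also have "\<dots> \<le> K"
      unfolding K_def using that G by (intro member_le_sum[of \<mu>]) (auto intro: sum_nonneg)
    finally show ?thesis by simp
  qed
  \<comment> \<open>The bound \<open>- K\<close> admits every weight in \<open>G\<close>, and even
    raising operators preserve it since they never decrease a block sum.\<close>
  define A where "A = {\<mu> \<in> weights m n M. \<forall>B\<in>blocks m n. - K \<le> bsum B \<mu>}"
  define T where "T = wsum A"
  have A: "A \<subseteq> weights m n M"
    by (auto simp: A_def)
  have "G \<subseteq> A"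
    using G K by (auto simp: A_def)
  have ST: "S \<subseteq> T"
  proof
    fix s assume s: "s \<in> S"
    then have "F s \<subseteq> A"
      using \<open>G \<subseteq> A\<close> by (auto simp: G_def)
    then show "s \<in> T"
      using F s subsetD[OF wsum_mono] unfolding T_def by metis
  qed
  have Tpos: "op i j v \<in> T" if ij: "i \<le> j" "j < m + n" "par i = par j" and v: "v \<in> T" for i j v
    unfolding T_def
  proof (rule op_wsum[OF _ ij(2) A _ v[unfolded T_def]])
    show i: "i < m + n" using ij by simp
    fix \<mu> assume \<mu>: "\<mu> \<in> A" "shift i j \<mu> \<in> weights m n M"
    have "- K \<le> bsum B (shift i j \<mu>)" if B: "B \<in> blocks m n" for B
    proof -
      have "bsum B (shift i j \<mu>) = bsum B \<mu> + of_bool (i \<in> B) - of_bool (j \<in> B)"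
        using bsum_shift[OF blocks_subset[OF B] i ij(2)] A \<mu>(1) weights_carrier by auto
      moreover have "- K \<le> bsum B \<mu>"
        using \<mu>(1) B by (simp add: A_def)
      ultimately show ?thesis
        using blocks_downward_closed[OF B, of j i] ij by (cases "i \<in> B"; cases "j \<in> B") simp_all
    qed
    then show "shift i j \<mu> \<in> A"
      using \<mu>(2) by (simp add: A_def)
  qed
  have AC: "A \<subseteq> bounded_weights (C + K)"
  proof
    fix \<mu> assume \<mu>: "\<mu> \<in> A"
    have "bsum B \<mu> \<le> C + K" if "B \<in> blocks m n" for B
    proof -
      obtain r where r: "r \<le> m + n" "B = {..<cnt 0 r} \<or> B = {m..<m + cnt 1 r}"
        using blocks_attained[OF \<open>B \<in> blocks m n\<close>] .
      have "bsum {..<cnt 0 r} \<mu> + bsum {m..<m + cnt 1 r} \<mu> \<le> C"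
        using ub[of \<mu> r] \<mu> A r(1) bsum_prefix_set[of r \<mu>] by auto
      moreover have "- K \<le> bsum {..<cnt 0 r} \<mu>" "- K \<le> bsum {m..<m + cnt 1 r} \<mu>"
        using \<mu> cnt_blocks[OF r(1)] by (auto simp: A_def)
      ultimately show ?thesis
        using r(2) by auto
    qed
    then show "\<mu> \<in> bounded_weights (C + K)"
      using \<mu> A by (auto simp: bounded_weights_def)
  qed
  define W where "W = neg_closure T"
  have T: "T \<subseteq> space M" "0 \<in> T"
    by (simp_all add: T_def wsum_subset_space subspace_0[OF subspace_wsum])
  have W: "subspace W" "W \<subseteq> space M"
    using T by (simp_all add: W_def subspace_neg_closure neg_closure_subset_space)
  have Weven: "op i j v \<in> W" if "i < m + n" "j < m + n" "par i = par j" "v \<in> W" for i j v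
    using that unfolding W_def by (intro neg_closure_even[OF T Tpos])
  \<comment> \<open>Even lowering operators keep the upper bound already valid on
    \<open>T\<close>.\<close>
  have Wb: "W \<subseteq> wsum (bounded_weights (C + K))"
    unfolding W_def
  proof (rule neg_closure_minimal[OF subspace_wsum])
    show "T \<subseteq> wsum (bounded_weights (C + K))"
      unfolding T_def by (rule wsum_mono[OF AC])
  qed (use op_bounded_weights(2) in auto)
  let ?D = "odd_span W (card odd_pairs)"
  have "S \<subseteq> ?D"
  proof
    fix s assume "s \<in> S"
    then have "s \<in> W"
      using ST by (auto simp: W_def intro: neg_closure.base)
    then show "s \<in> ?D"
      using odd_span_word[of "[]" "card odd_pairs" s W] by simp
  qed
  moreover have "is_submodule m n M ?D"
    by (rule odd_span_submodule[OF W Weven])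
  ultimately have "space M = ?D"
    using S(3) by metis
  then have "space M \<subseteq> wsum (bounded_weights (C + K + real (card odd_pairs)))"
    using odd_span_bounded[OF Wb] by simp
  moreover have "bounded_weights c \<subseteq> carrier_vec (m + n)" for c
    using weights_carrier by (auto simp: bounded_weights_def)
  ultimately show ?thesis
    using weights_subset_if_space[OF ss] by metis
qed

end

section \<open>Independence of the sequence\<close>

context complex_vector_space
begin

text \<open>Only the cone clause of \<open>in_O\<close> mentions the sequence. It is turned into
  bounds on block sums, which no longer depend on \<open>b\<close>, and then into cones for
  \<open>b'\<close>.\<close>

lemma in_O_change_sequence:
  assumes b: "is_01_sequence m n b" and b': "is_01_sequence m n b'" and M: "in_O m n b M"
  shows "in_O m n b' M"
proof -
  interpret s: seq01 m n b by unfold_locales (rule b)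
  interpret s': seq01 m n b' by unfold_locales (rule b')
  interpret gl_module scale m n M
    using M by unfold_locales (simp add: in_O_def)
  from M have fg: "finitely_generated m n M" and ss: "cartan_semisimple m n M"
    and ids: "internal_direct_sum (space M) (integral_weights m n) (weight_space m n M)"
    by (simp_all add: in_O_def)
  obtain L where L: "finite L" "\<And>\<mu>. \<mu> \<in> weights m n M \<Longrightarrow> \<exists>l\<in>L. \<mu> \<in> lower_cone m n b l"
    using M unfolding in_O_def by blast
  define C where "C = (\<Sum>l\<in>L. \<Sum>r\<le>m + n. \<bar>bsum (s.prefix_set r) l\<bar>)"
  have C: "\<bar>bsum (s.prefix_set r) l\<bar> \<le> C" if "l \<in> L" "r \<le> m + n" for l r
  proof -
    have "\<bar>bsum (s.prefix_set r) l\<bar> \<le> (\<Sum>r\<le>m + n. \<bar>bsum (s.prefix_set r) l\<bar>)"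
      using that by (intro member_le_sum[of r]) auto
    also have "\<dots> \<le> C"
      unfolding C_def using that L(1) by (intro member_le_sum[of l]) (auto intro: sum_nonneg)
    finally show ?thesis .
  qed
  have ub: "bsum (s.prefix_set r) \<mu> \<le> C" if "\<mu> \<in> weights m n M" "r \<le> m + n" for \<mu> r
  proof -
    obtain l where l: "l \<in> L" "\<mu> \<in> lower_cone m n b l"
      using L(2)[OF \<open>\<mu> \<in> weights m n M\<close>] by blast
    show ?thesis
      using s.lower_cone_prefix(1)[OF l(2) that(2)] C[OF l(1) that(2)] by simp
  qed
  \<comment> \<open>The total equals that of an apex, so it is bounded from below as well.\<close>
  have lb: "- C \<le> bsum {..<m + n} \<mu>" if "\<mu> \<in> weights m n M" for \<mu>
  proof -
    obtain l where l: "l \<in> L" "\<mu> \<in> lower_cone m n b l"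
      using L(2)[OF \<open>\<mu> \<in> weights m n M\<close>] by blast
    show ?thesis
      using s.lower_cone_prefix(2)[OF l(2) order_refl refl] C[OF l(1), of "m + n"]
      unfolding s.prefix_set_full by simp
  qed
  obtain c where c: "weights m n M \<subseteq> bounded_weights c"
    using block_sums_bounded[OF s.seq01_axioms ss fg ub] by blast
  have int: "integral_weights m n \<subseteq> carrier_vec (m + n)"
    by (auto simp: integral_weights_def)
  \<comment> \<open>\<open>weights\<close> ranges over the whole dual of the Cartan subalgebra;
    integrality of all weights follows because integral weight spaces already span.\<close>
  have "space M \<subseteq> wsum (integral_weights m n)"
    using space_decompose[OF ids int] subsetD[OF wsum_mono] by (meson le_inf_iff subsetI)
  then have wint: "weights m n M \<subseteq> integral_weights m n"
    by (rule weights_subset_if_space[OF ss int])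
  \<comment> \<open>Each half of a prefix set for \<open>b'\<close> is a block with sum at most
    \<open>c\<close>; adding \<open>\<bar>C\<bar>\<close> gives one constant for both bounds in
    \<open>finite_cones\<close>.\<close>
  have ub': "bsum (s'.prefix_set r) \<mu> \<le> \<bar>C\<bar> + 2 * \<bar>c\<bar>" if "\<mu> \<in> weights m n M" "r \<le> m + n" for \<mu> r
  proof -
    have "bsum {..<s'.cnt 0 r} \<mu> \<le> c" "bsum {m..<m + s'.cnt 1 r} \<mu> \<le> c"
      using c that s'.cnt_blocks[OF that(2)] by (auto simp: bounded_weights_def)
    then show ?thesis
      unfolding s'.bsum_prefix_set[OF that(2)] by linarith
  qed
  have lb': "- (\<bar>C\<bar> + 2 * \<bar>c\<bar>) \<le> bsum {..<m + n} \<mu>" if "\<mu> \<in> weights m n M" for \<mu>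
    using lb[OF that] by linarith
  have "\<exists>L. finite L \<and> L \<subseteq> integral_weights m n \<and>
      (\<forall>\<mu>\<in>weights m n M. \<exists>l\<in>L. \<mu> \<in> lower_cone m n b' l)"
    by (rule s'.finite_cones[OF wint ub' lb'])
  then show ?thesis
    using M by (simp add: in_O_def)
qed

end

theorem proposition6p4:
  fixes scale :: "complex \<Rightarrow> 'v::ab_group_add \<Rightarrow> 'v" and m n :: nat and b b' :: "nat list"
  assumes "complex_vector_space scale"
    and "is_01_sequence m n b" and "is_01_sequence m n b'"
  shows "complex_vector_space.category_O scale m n b = complex_vector_space.category_O scale m n b'"
proof -
  interpret complex_vector_space scale by (rule assms(1))
  \<comment> \<open>The sequence enters objects and morphisms only through
    \<open>in_O\<close>.\<close>
  have "in_O m n b M \<longleftrightarrow> in_O m n b' M" for M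
    using in_O_change_sequence assms(2,3) by blast
  then show ?thesis
    by (simp add: category_O_def)
qed

end
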